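(* In $\mathbf{sNSym}$ we have $\tilde P_0=\Psi_0$, and for every $n\ge1$, $$(n+1)\tilde P_n=(n+1)\Psi_n+\sum_{k=0}^{n-1}[P_{n-k},\Psi_k],$$ where $[x,y]=xy-yx$.
   Context: $\mathbf{sNSym}$, as an algebra, is the free associative unital $\mathbb Q$-algebra on generators $H_n$ ($n\ge1$) and $\tilde H_n$ ($n\ge0$), with $H_0=1$. The elements $\Psi_n$ are defined by $\Psi_0=\tilde H_0$ and $\Psi_n=\tilde H_n-\sum_{k=0}^{n-1}H_{n-k}\Psi_k$ for $n\ge1$. The noncommutative power sums in superspace $P_n,\tilde P_n$ are defined by the generating function identity $\lambda(t,\tau)\Pi(t,\tau)=(t\partial_t+\tau\partial_\tau)\lambda(t,\tau)$, where $\lambda(t,\tau)=\sum_{n\ge0}t^n(H_n+\tau\tilde H_n)$ and $\Pi(t,\tau)=\sum_{n\ge0}t^n(P_n+\tau(n+1)\tilde P_n)$, $\tau^2=0$. Explicitly: $P_0=0$, $\sum_{k=0}^{n-1}H_kP_{n-k}=nH_n$ for $n\ge1$, and $\sum_{k=0}^n\left(\tilde H_{n-k}P_k+(k+1)H_{n-k}\tilde P_k\right)=(n+1)\tilde H_n$ for $n\ge0$. *)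

theory Defs
  imports
    "HOL-Library.Poly_Mapping"
    "HOL-Computational_Algebra.Formal_Power_Series"
begin

section \<open>The free associative algebra\<close>

text \<open>
  The free monoid, written additively: multiplication of \<^typ>\<open>'a \<Rightarrow>\<^sub>0 'b\<close> is convolution with
  respect to addition of the exponents, so concatenation of words has to be a \<open>+\<close>.
\<close>

datatype 'a free_monoid = Word (letters: "'a list")

instantiation free_monoid :: (type) monoid_add
begin

definition zero_free_monoid :: "'a free_monoid"
  where "0 = Word []"

definition plus_free_monoid :: "'a free_monoid \<Rightarrow> 'a free_monoid \<Rightarrow> 'a free_monoid"
  where "u + v = Word (letters u @ letters v)"

instance
  by standard (simp_all add: zero_free_monoid_def plus_free_monoid_def)

end

text \<open>
  \<open>EvenGen n\<close> stands for $H_{n+1}$ (recall that $H_0 = 1$ is not a generator) and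
  \<open>OddGen n\<close> for $\tilde H_n$.
\<close>

datatype generator = EvenGen nat | OddGen nat

text \<open>
  The free unital associative algebra over the rationals is the monoid algebra of the free monoid.
\<close>

type_synonym sNSym = "generator free_monoid \<Rightarrow>\<^sub>0 rat"

definition gen :: "generator \<Rightarrow> sNSym"
  where "gen g = Poly_Mapping.single (Word [g]) 1"

definition scale :: "rat \<Rightarrow> sNSym \<Rightarrow> sNSym"
  where "scale c x = Poly_Mapping.single 0 c * x"

fun H :: "nat \<Rightarrow> sNSym" where
  "H 0 = 1"
| "H (Suc n) = gen (EvenGen n)"

definition Ht :: "nat \<Rightarrow> sNSym"
  where "Ht n = gen (OddGen n)"

definition commutator :: "'a::ring \<Rightarrow> 'a \<Rightarrow> 'a"
  where "commutator x y = x * y - y * x"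


section \<open>The elements \<open>\<Psi>\<^sub>n\<close> and the power sums in superspace\<close>

fun Psi :: "nat \<Rightarrow> sNSym" where
  "Psi n = Ht n - (\<Sum>k<n. H (n - k) * Psi k)"

declare Psi.simps [simp del]

text \<open>
  The next two definitions are the relations obtained by comparing coefficients in
  $\lambda \Pi = (t\partial_t + \tau\partial_\tau)\lambda$, solved for the term with the
  largest index; see \<open>power_sum_genfun_iff\<close> below.
\<close>

fun P :: "nat \<Rightarrow> sNSym" where
  "P n = of_nat n * H n - (\<Sum>k\<in>{1..<n}. H k * P (n - k))"

declare P.simps [simp del]

fun Pt :: "nat \<Rightarrow> sNSym" where
  "Pt n = scale (1 / of_nat (n + 1))
     (of_nat (n + 1) * Ht n - (\<Sum>k\<le>n. Ht (n - k) * P k)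
        - (\<Sum>k<n. of_nat (k + 1) * H (n - k) * Pt k))"

declare Pt.simps [simp del]


section \<open>The generating function identity\<close>

text \<open>
  A pair \<open>(A, B)\<close> represents the series $A(t) + \tau B(t)$, where $\tau$ commutes
  with the coefficients and with $t$, and $\tau^2 = 0$.
\<close>

type_synonym superseries = "sNSym fps \<times> sNSym fps"

definition super_mult :: "superseries \<Rightarrow> superseries \<Rightarrow> superseries"
  where "super_mult x y = (fst x * fst y, fst x * snd y + snd x * fst y)"

text \<open>The operator $t\partial_t + \tau\partial_\tau$.\<close>

definition super_euler :: "superseries \<Rightarrow> superseries"
  where "super_euler x = (fps_X * fps_deriv (fst x), fps_X * fps_deriv (snd x) + snd x)"

definition lambda_series :: superseries
  where "lambda_series = (Abs_fps H, Abs_fps Ht)"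

definition Pi_series :: "(nat \<Rightarrow> sNSym) \<Rightarrow> (nat \<Rightarrow> sNSym) \<Rightarrow> superseries"
  where "Pi_series p q = (Abs_fps p, Abs_fps (\<lambda>n. of_nat (n + 1) * q n))"

lemma scale_of_nat: "scale (of_nat n) x = of_nat n * x"
  by (simp add: scale_def single_of_nat)

lemma scale_scale: "scale a (scale b x) = scale (a * b) x"
  by (simp add: scale_def mult.assoc[symmetric] mult_single)

lemma scale_1 [simp]: "scale 1 x = x"
  unfolding scale_def single_one by simp

lemma eq_scale_inverse_iff:
  "x = scale (1 / of_nat (n + 1)) y \<longleftrightarrow> of_nat (n + 1) * x = y"
proof -
  have inv: "1 / of_nat (n + 1) * of_nat (n + 1) = (1::rat)"
    "of_nat (n + 1) * (1 / of_nat (n + 1)) = (1::rat)"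
    by (simp_all del: of_nat_Suc)
  show ?thesis
  proof
    assume "x = scale (1 / of_nat (n + 1)) y"
    then show "of_nat (n + 1) * x = y"
      unfolding scale_of_nat[symmetric] by (simp only: scale_scale inv scale_1)
  next
    assume "of_nat (n + 1) * x = y"
    then show "x = scale (1 / of_nat (n + 1)) y"
      unfolding scale_of_nat[symmetric] by (auto simp only: scale_scale inv scale_1)
  qed
qed

lemma even_relation_iff:
  "(\<forall>n. (\<Sum>k\<le>n. H k * p (n - k)) = of_nat n * H n) \<longleftrightarrow> p = P"
proof -
  have split: "(\<Sum>k\<le>n. H k * p (n - k)) = p n + (\<Sum>k\<in>{1..<n}. H k * p (n - k))
      + (if n = 0 then 0 else H n * p 0)" for n p
  proof (cases n)
    case (Suc m)
    have "{..n} = insert 0 (insert n {1..<n})" "0 \<notin> insert n {1..<n}" using Suc by auto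
    then show ?thesis using Suc by (simp add: algebra_simps)
  qed simp
  have P0: "P 0 = 0" by (subst P.simps) simp
  show ?thesis
  proof
    assume *: "\<forall>n. (\<Sum>k\<le>n. H k * p (n - k)) = of_nat n * H n"
    from *[rule_format, of 0] have p0: "p 0 = 0" by simp
    have "p n = P n" for n
    proof (induction n rule: less_induct)
      case (less n)
      have "(\<Sum>k\<in>{1..<n}. H k * p (n - k)) = (\<Sum>k\<in>{1..<n}. H k * P (n - k))"
        using less by (intro sum.cong) auto
      moreover have "(if n = 0 then 0 else H n * p 0) = 0" using p0 by simp
      ultimately show ?case
        using *[rule_format, of n] unfolding split P.simps[of n]
        by (simp only: add_0_right eq_diff_eq)
    qed
    then show "p = P" by blast
  next
    assume "p = P"
    have "(\<Sum>k\<le>n. H k * P (n - k)) = of_nat n * H n" for n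
    proof -
      have "(if n = 0 then 0 else H n * P 0) = 0" using P0 by simp
      then show ?thesis unfolding split P.simps[of n] by (simp only: add_0_right diff_add_cancel)
    qed
    then show "\<forall>n. (\<Sum>k\<le>n. H k * p (n - k)) = of_nat n * H n"
      using \<open>p = P\<close> by simp
  qed
qed

lemma odd_relation_iff:
  "(\<forall>n. (\<Sum>k\<le>n. Ht (n - k) * P k + of_nat (k + 1) * H (n - k) * q k) = of_nat (n + 1) * Ht n)
     \<longleftrightarrow> q = Pt"
  (is "(\<forall>n. ?rel q n) \<longleftrightarrow> _")
proof -
  have solve: "?rel q n \<longleftrightarrow> q n = scale (1 / of_nat (n + 1))
     (of_nat (n + 1) * Ht n - (\<Sum>k\<le>n. Ht (n - k) * P k)
        - (\<Sum>k<n. of_nat (k + 1) * H (n - k) * q k))" for q n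
    unfolding eq_scale_inverse_iff
    by (simp add: sum.distrib lessThan_Suc_atMost[symmetric] del: of_nat_Suc)
       (auto simp: algebra_simps)
  show ?thesis
  proof
    assume *: "\<forall>n. ?rel q n"
    have "q n = Pt n" for n
    proof (induction n rule: less_induct)
      case (less n)
      have "(\<Sum>k<n. of_nat (k + 1) * H (n - k) * q k)
          = (\<Sum>k<n. of_nat (k + 1) * H (n - k) * Pt k)"
        using less by (intro sum.cong) auto
      then show ?case
        using *[rule_format, of n] unfolding solve Pt.simps[of n] by (simp only:)
    qed
    then show "q = Pt" by blast
  next
    assume "q = Pt"
    have "?rel Pt n" for n
      unfolding solve by (rule Pt.simps)
    then show "\<forall>n. ?rel q n" using \<open>q = Pt\<close> by simp
  qed
qed

theorem power_sum_genfun_iff: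
  "super_mult lambda_series (Pi_series p q) = super_euler lambda_series \<longleftrightarrow> p = P \<and> q = Pt"
proof -
  have euler0: "fps_nth (fps_X * fps_deriv (Abs_fps H)) n = of_nat n * H n" for n
    by (cases n) (simp_all del: H.simps)
  have even: "fst (super_mult lambda_series (Pi_series p q)) = fst (super_euler lambda_series)
      \<longleftrightarrow> (\<forall>n. (\<Sum>k\<le>n. H k * p (n - k)) = of_nat n * H n)"
    unfolding super_mult_def super_euler_def lambda_series_def Pi_series_def fps_eq_iff
    unfolding fst_conv snd_conv fps_mult_nth[of "Abs_fps H"] atLeast0AtMost fps_nth_Abs_fps euler0 ..
  have coeff: "fps_nth (Abs_fps H * Abs_fps (\<lambda>n. of_nat (n + 1) * q n) + Abs_fps Ht * Abs_fps p) n
      = (\<Sum>k\<le>n. Ht (n - k) * p k + of_nat (k + 1) * H (n - k) * q k)" for n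
  proof -
    have "(\<Sum>k\<le>n. H k * (of_nat (n - k + 1) * q (n - k)))
        = (\<Sum>k\<le>n. H (n - k) * (of_nat (k + 1) * q k))"
      by (rule sum.reindex_bij_witness[where i = "\<lambda>k. n - k" and j = "\<lambda>k. n - k"]) auto
    also have "\<dots> = (\<Sum>k\<le>n. of_nat (k + 1) * H (n - k) * q k)"
      by (intro sum.cong refl) (simp only: mult.assoc[symmetric] mult_of_nat_commute[of _ "H m" for m])
    finally have 1: "(\<Sum>k\<le>n. H k * (of_nat (n - k + 1) * q (n - k)))
        = (\<Sum>k\<le>n. of_nat (k + 1) * H (n - k) * q k)" .
    have 2: "(\<Sum>k\<le>n. Ht k * p (n - k)) = (\<Sum>k\<le>n. Ht (n - k) * p k)"
      by (rule sum.reindex_bij_witness[where i = "\<lambda>k. n - k" and j = "\<lambda>k. n - k"]) auto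
    show ?thesis
      using 1 2 by (simp add: fps_mult_nth atLeast0AtMost sum.distrib add.commute)
  qed
  have euler: "fps_nth (fps_X * fps_deriv (Abs_fps Ht) + Abs_fps Ht) n = of_nat (n + 1) * Ht n" for n
    by (cases n) (simp_all add: algebra_simps)
  have odd: "snd (super_mult lambda_series (Pi_series p q)) = snd (super_euler lambda_series)
      \<longleftrightarrow> (\<forall>n. (\<Sum>k\<le>n. Ht (n - k) * p k + of_nat (k + 1) * H (n - k) * q k)
                = of_nat (n + 1) * Ht n)"
    unfolding super_mult_def super_euler_def lambda_series_def Pi_series_def fps_eq_iff
      fst_conv snd_conv coeff euler ..
  show ?thesis
    unfolding prod_eq_iff even odd even_relation_iff using odd_relation_iff by blast
qed

end

theory Submission
  imports Defs
begin

text \<open>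
  In terms of the series \<open>h = \<Sum> H\<^sub>n t\<^sup>n\<close>, \<open>ht = \<Sum> Ht\<^sub>n t\<^sup>n\<close>, \<open>\<psi> = \<Sum> Psi\<^sub>n t\<^sup>n\<close>,
  \<open>p = \<Sum> P\<^sub>n t\<^sup>n\<close> and \<open>q = \<Sum> (n + 1) Pt\<^sub>n t\<^sup>n\<close>, the recursion for \<open>Psi\<close> says \<open>ht = h \<psi>\<close>,
  and the generating function identity for the power sums (\<open>power_sum_genfun_iff\<close>) says
  \<open>h p = t h'\<close> and \<open>h q + ht p = t ht' + ht\<close>. Substitute \<open>ht = h \<psi>\<close> in the latter: by the Leibniz
  rule \<open>t (h \<psi>)' = (t h') \<psi> + h (t \<psi>') = h p \<psi> + h t \<psi>'\<close>, so that every term has the left factor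
  \<open>h\<close>. As \<open>h\<close> has constant term 1 it can be cancelled, and what remains is
  \<open>q = t \<psi>' + \<psi> + [p, \<psi>]\<close>. The coefficients of this identity (\<open>fps_odd_part_of_log_derivative\<close>)
  are the claim; the summand \<open>k = n\<close> of the commutator vanishes because \<open>P 0 = 0\<close>.
\<close>

text \<open>
  In the Leibniz expansion of \<open>t (h \<psi>)'\<close> the centrality of \<open>t\<close> moves the factor \<open>h\<close> to the far left,
  where the left inverse of \<open>h\<close> removes it. The factor \<open>p\<close> ends up to the left of \<open>\<psi>\<close> in the term
  that comes from \<open>t h' = h p\<close> and to its right in the term \<open>h \<psi> p\<close>, whence the commutator.
\<close>

lemma fps_odd_part_of_log_derivative:
  fixes h \<psi> p q :: "'a::ring_1 fps"
  assumes h0: "fps_nth h 0 = 1"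
    and even: "h * p = fps_X * fps_deriv h"
    and odd: "h * q + (h * \<psi>) * p = fps_X * fps_deriv (h * \<psi>) + h * \<psi>"
  shows "q = fps_X * fps_deriv \<psi> + \<psi> + commutator p \<psi>"
proof -
  have "fps_X * fps_deriv (h * \<psi>) = fps_X * (h * fps_deriv \<psi>) + h * p * \<psi>"
    by (simp only: even fps_deriv_mult distrib_left mult.assoc)
  also have "fps_X * (h * fps_deriv \<psi>) = h * (fps_X * fps_deriv \<psi>)"
    by (simp only: mult.assoc[symmetric] fps_mult_fps_X_commute[of h, symmetric])
  finally have "h * q = h * (fps_X * fps_deriv \<psi> + \<psi> + commutator p \<psi>)"
    using odd by (simp add: commutator_def algebra_simps)
  then have "fps_left_inverse h 1 * h * q
      = fps_left_inverse h 1 * h * (fps_X * fps_deriv \<psi> + \<psi> + commutator p \<psi>)"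
    by (simp only: mult.assoc)
  moreover have "fps_left_inverse h 1 * h = 1"
    using h0 by (intro fps_left_inverse) simp
  ultimately show ?thesis
    by simp
qed

lemma Ht_series_eq: "Abs_fps Ht = Abs_fps H * Abs_fps Psi"
proof (rule fps_ext)
  fix n
  have "fps_nth (Abs_fps H * Abs_fps Psi) n = (\<Sum>k\<le>n. H k * Psi (n - k))"
    by (simp add: fps_mult_nth atLeast0AtMost)
  also have "\<dots> = (\<Sum>k\<le>n. H (n - k) * Psi k)"
    by (rule sum.reindex_bij_witness[where i = "\<lambda>k. n - k" and j = "\<lambda>k. n - k"]) auto
  also have "\<dots> = Ht n"
    by (simp add: lessThan_Suc_atMost[symmetric] Psi.simps[of n])
  finally show "fps_nth (Abs_fps Ht) n = fps_nth (Abs_fps H * Abs_fps Psi) n"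
    by simp
qed

lemma fps_nth_commutator:
  fixes f g :: "'a::ring fps"
  shows "fps_nth (commutator f g) n = (\<Sum>k\<le>n. commutator (fps_nth f (n - k)) (fps_nth g k))"
proof -
  have "(\<Sum>k\<le>n. fps_nth f k * fps_nth g (n - k)) = (\<Sum>k\<le>n. fps_nth f (n - k) * fps_nth g k)"
    by (rule sum.reindex_bij_witness[where i = "\<lambda>k. n - k" and j = "\<lambda>k. n - k"]) auto
  then show ?thesis
    by (simp add: commutator_def fps_mult_nth atLeast0AtMost sum_subtractf)
qed

lemma Pt_eq_Psi_plus_commutators:
  "of_nat (n + 1) * Pt n = of_nat (n + 1) * Psi n + (\<Sum>k<n. commutator (P (n - k)) (Psi k))"
proof -
  let ?q = "Abs_fps (\<lambda>n. of_nat (n + 1) * Pt n)" and ?\<psi> = "Abs_fps Psi" and ?p = "Abs_fps P"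
  have genfun: "super_mult lambda_series (Pi_series P Pt) = super_euler lambda_series"
    by (simp add: power_sum_genfun_iff)
  have q: "?q = fps_X * fps_deriv ?\<psi> + ?\<psi> + commutator ?p ?\<psi>"
  proof (rule fps_odd_part_of_log_derivative)
    show "fps_nth (Abs_fps H) 0 = 1"
      by simp
    show "Abs_fps H * ?p = fps_X * fps_deriv (Abs_fps H)"
      using arg_cong[OF genfun, of fst]
      by (simp only: super_mult_def super_euler_def lambda_series_def Pi_series_def fst_conv snd_conv)
    show "Abs_fps H * ?q + (Abs_fps H * ?\<psi>) * ?p
        = fps_X * fps_deriv (Abs_fps H * ?\<psi>) + Abs_fps H * ?\<psi>"
      using arg_cong[OF genfun, of snd]
      by (simp only: super_mult_def super_euler_def lambda_series_def Pi_series_def fst_conv snd_conv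
          Ht_series_eq)
  qed
  have euler: "fps_nth (fps_X * fps_deriv ?\<psi> + ?\<psi>) n = of_nat (n + 1) * Psi n"
    by (cases n) (simp_all add: algebra_simps)
  have "P 0 = 0"
    by (subst P.simps) simp
  then have P0: "commutator (P 0) x = 0" for x
    by (simp add: commutator_def)
  have "of_nat (n + 1) * Pt n = fps_nth ?q n"
    by (simp only: fps_nth_Abs_fps)
  also have "\<dots> = of_nat (n + 1) * Psi n + (\<Sum>k\<le>n. commutator (P (n - k)) (Psi k))"
    by (simp only: q fps_add_nth[of _ "commutator _ _"] euler fps_nth_commutator fps_nth_Abs_fps)
  also have "(\<Sum>k\<le>n. commutator (P (n - k)) (Psi k)) = (\<Sum>k<n. commutator (P (n - k)) (Psi k))"
    by (simp add: lessThan_Suc_atMost[symmetric] P0)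
  finally show ?thesis .
qed

theorem proposition5p7:
  shows "Pt 0 = Psi 0 \<and>
    (\<forall>n::nat. n \<ge> 1 \<longrightarrow>
      of_nat (n + 1) * Pt n =
        of_nat (n + 1) * Psi n + (\<Sum>k = 0..n - 1. commutator (P (n - k)) (Psi k)))"
proof (intro conjI allI impI)
  show "Pt 0 = Psi 0"
    using Pt_eq_Psi_plus_commutators[of 0] by simp
next
  fix n :: nat
  assume "n \<ge> 1"
  then have "{0..n - 1} = {..<n}"
    by auto
  then show "of_nat (n + 1) * Pt n
      = of_nat (n + 1) * Psi n + (\<Sum>k = 0..n - 1. commutator (P (n - k)) (Psi k))"
    by (simp only: Pt_eq_Psi_plus_commutators)
qed

end
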